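(* Suppose that Assumption A (semicontinuity) and Assumption B (light tail), both stated in the context, hold. Let $\beta\in(0,1)$, and let $\pi^\star_{\hat w}$ and $v^\star_{\hat w}$ denote an optimal distributionally robust policy and the optimal value function of the distributionally robust control problem $\inf_{\pi\in\Pi}\sup_{\gamma\in\Gamma}J_{\boldsymbol{x}}(\pi,\gamma)$ with training dataset $\hat w=\{\hat w^{(1)},\ldots,\hat w^{(N)}\}$ and the Wasserstein ball radius $\theta=\theta(N,\beta)$ given by $$\theta(N,\beta):=\begin{cases}\big[\frac{1}{Nc_2}\log(\frac{c_1}{\beta})\big]^{p/q} & \text{if } N<\frac{1}{c_2}\log(\frac{c_1}{\beta}),\\[2pt] \big[\frac{1}{Nc_2}\log(\frac{c_1}{\beta})\big]^{1/2} & \text{if } N\ge\frac{1}{c_2}\log(\frac{c_1}{\beta}) \text{ and } p>\frac l2,\\[2pt] \big[\frac{1}{Nc_2}\log(\frac{c_1}{\beta})\big]^{p/l} & \text{if } N\ge\frac{1}{c_2}\log(\frac{c_1}{\beta}) \text{ and } p<\frac l2,\\[2pt] \bar\theta & \text{if } N\ge\frac{(\log 3)^2}{c_2}\log(\frac{c_1}{\beta}) \text{ and } p=\frac l2,\end{cases}$$ where $\bar\theta$ satisfies $\frac{\bar\theta}{\log(2+1/\bar\theta)}=\big[\frac{1}{Nc_2}\log(\frac{c_1}{\beta})\big]^{1/2}$, and $c_1,c_2$ are the positive constants of the measure concentration inequality stated in the context. Then the following probabilistic out-of-sample performance guarantee holds: $$\mu^N\Big\{\hat w \ \Big|\ \mathbb{E}^{\pi^\star_{\hat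 w}}_{w_t\sim\mu}\Big[\sum_{t=0}^\infty\alpha^t c(x_t,u_t)\ \Big|\ x_0=\boldsymbol{x}\Big]\le v^\star_{\hat w}(\boldsymbol{x})\ \ \forall \boldsymbol{x}\in\mathcal{X}\Big\}\ge 1-\beta.$$
   Context: Setting. $\mathcal{X}\subseteq\mathbb{R}^n$, $\mathcal{U}\subseteq\mathbb{R}^m$, $\mathcal{W}\subseteq\mathbb{R}^l$ are Borel sets; the system is $x_{t+1}=f(x_t,u_t,w_t)$ with state $x_t\in\mathcal{X}$, input $u_t\in\mathcal{U}(x_t)\subseteq\mathcal{U}$ and random disturbance $w_t\in\mathcal{W}$. $\mathbb{K}:=\{(\boldsymbol{x},\boldsymbol{u})\in\mathcal{X}\times\mathcal{U}\mid \boldsymbol{u}\in\mathcal{U}(\boldsymbol{x})\}$; $c:\mathcal{X}\times\mathcal{U}\to\mathbb{R}$ is the stage cost; $\alpha\in(0,1)$ is the discount factor. $\mathcal{P}(\mathcal{W})$ is the set of Borel probability measures on $\mathcal{W}$. Ambiguity set. The $w_t$ are i.i.d. with true (unknown) distribution $\mu\in\mathcal{P}(\mathcal{W})$. The training samples $\hat w^{(1)},\ldots,\hat w^{(N)}$ are drawn i.i.d. from $\mu$, so $\hat w$ has law $\mu^N$ (the $N$-fold product). $\nu_N:=\frac1N\sum_{i=1}^N\delta_{\hat w^{(i)}}$. $W_p$ is the Wasserstein distance of order $p\in[1,\infty)$ for a metric $d$ on $\mathcal{W}$: $W_p(\mu',\nu)=\min_\kappa[\int d(w,w')^p\kappa(\mathrm{d}w,\mathrm{d}w')]^{1/p}$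 over couplings $\kappa$ of $\mu'$ and $\nu$. For radius $\theta>0$, $\mathcal{D}:=\{\mu'\in\mathcal{P}(\mathcal{W})\mid W_p(\mu',\nu_N)\le\theta\}$. Game. Histories are $h_t=(x_0,u_0,\ldots,x_{t-1},u_{t-1},x_t)\in H_t$ and extended histories are $h^e_t=(x_0,u_0,\mu_0,\ldots,x_{t-1},u_{t-1},\mu_{t-1},x_t,u_t)\in H^e_t$. $\Pi$ is the set of sequences $\pi=(\pi_0,\pi_1,\ldots)$ of stochastic kernels $\pi_t$ from $H_t$ to $\mathbb{R}^m$ with $\pi_t(\mathcal{U}(x_t)|h_t)=1$ for all $h_t$. $\Gamma$ is the set of sequences $\gamma=(\gamma_0,\gamma_1,\ldots)$ of stochastic kernels $\gamma_t$ from $H_t^e$ to $\mathcal{P}(\mathcal{W})$ with $\gamma_t(\mathcal{D}|h^e_t)=1$ for all $h_t^e$; at stage $t$ Player II chooses the distribution $\mu_t$ of $w_t$. $J_{\boldsymbol{x}}(\pi,\gamma):=\mathbb{E}^{\pi,\gamma}[\sum_{t=0}^\infty\alpha^tc(x_t,u_t)\mid x_0=\boldsymbol{x}]$. The optimal value function is $v^\star(\boldsymbol{x})=\inf_{\pi\in\Pi}\sup_{\gamma\in\Gamma}J_{\boldsymbol{x}}(\pi,\gamma)$, and $\pi^\star\in\Pi$ is an optimal distributionally robust policy if $\sup_{\gamma\in\Gamma}J_{\boldsymbol{x}}(\pi^\star,\gamma)\le\sup_{\gamma'\in\Gamma}J_{\boldsymbol{x}}(\pi,\gamma')$ for all $\pi\in\Pi$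 (and all $\boldsymbol{x}$). The subscript $\hat w$ indicates dependence on the dataset through $\nu_N$. $\mathbb{E}^{\pi}_{w_t\sim\mu}$ is the expectation when policy $\pi$ is used and the $w_t$ are i.i.d. with law $\mu$ (independent of the training data). Assumption A. (1) $c$ is lower semicontinuous on $\mathbb{K}$ and $|c(\boldsymbol{x},\boldsymbol{u})|\le b\,\xi(\boldsymbol{x})$ on $\mathbb{K}$ for some constant $b\ge0$ and continuous $\xi:\mathcal{X}\to[1,\infty)$ such that $\xi'(\boldsymbol{x},\boldsymbol{u}):=\int_{\mathcal{W}}\xi(f(\boldsymbol{x},\boldsymbol{u},w))\boldsymbol{\mu}(\mathrm{d}w)$ is continuous on $\mathbb{K}$ for every $\boldsymbol{\mu}\in\mathcal{D}$; and there is a constant $\beta_\xi\in[1,1/\alpha)$ with $\xi'(\boldsymbol{x},\boldsymbol{u})\le\beta_\xi\,\xi(\boldsymbol{x})$ for all $(\boldsymbol{x},\boldsymbol{u})\in\mathbb{K}$ (and every $\boldsymbol{\mu}\in\mathcal{D}$). (2) For each continuous bounded $\chi:\mathcal{X}\to\mathbb{R}$, $\chi'(\boldsymbol{x},\boldsymbol{u}):=\int_{\mathcal{W}}\chi(f(\boldsymbol{x},\boldsymbol{u},w))\boldsymbol{\mu}(\mathrm{d}w)$ is continuous on $\mathbb{K}$ for every $\boldsymbol{\mu}\in\mathcal{D}$. (3) $\mathcal{U}(\boldsymbol{x})$ is compact for every $\boldsymbol{x}\in\mathcal{X}$ and $\boldsymbol{x}\mapsto\mathcal{U}(\boldsymbol{x})$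 is upper semicontinuous. Assumption B (light tail). There is a constant $q>p$ with $\rho:=\int_{\mathcal{W}}\exp(\|w\|^q)\,\mathrm{d}\mu(w)<+\infty$. Measure concentration (cited by the paper from Fournier and Guillin; defines $c_1,c_2$). Under Assumption B, $c_1,c_2>0$ are constants depending only on $l,q,\rho$ such that $\mu^N\{\hat w\mid W_p(\mu,\nu_N)\ge\theta\}\le c_1[b_1(N,\theta)\mathbf{1}_{\{\theta\le1\}}+b_2(N,\theta)\mathbf{1}_{\{\theta>1\}}]$, where $b_1(N,\theta)=\exp(-c_2N\theta^2)$ if $p>l/2$, $b_1(N,\theta)=\exp(-c_2N(\theta/\log(2+1/\theta))^2)$ if $p=l/2$, $b_1(N,\theta)=\exp(-c_2N\theta^{l/p})$ otherwise, and $b_2(N,\theta)=\exp(-c_2N\theta^{q/p})$. *)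

theory Defs
  imports "HOL-Probability.Probability"
begin

record ('n::finite, 'm::finite, 'l::finite) control_system =
  states :: "(real^'n) set"
  inputs :: "(real^'m) set"
  disturbances :: "(real^'l) set"
  admissible :: "real^'n \<Rightarrow> (real^'m) set"
  dynamics :: "real^'n \<Rightarrow> real^'m \<Rightarrow> real^'l \<Rightarrow> real^'n"
  stage_cost :: "real^'n \<Rightarrow> real^'m \<Rightarrow> real"
  discount :: real

type_synonym ('n, 'm) state_input = "(real^'n) \<times> (real^'m)"

definition feasible_pairs :: "('n::finite, 'm::finite, 'l::finite) control_system \<Rightarrow> ('n, 'm) state_input set"
  where "feasible_pairs S = {(x, u). x \<in> states S \<and> u \<in> inputs S \<and> u \<in> admissible S x}"

abbreviation state_space :: "('n::finite, 'm::finite, 'l::finite) control_system \<Rightarrow> (real^'n) measure"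
  where "state_space S \<equiv> restrict_space borel (states S)"

abbreviation disturbance_space :: "('n::finite, 'm::finite, 'l::finite) control_system \<Rightarrow> (real^'l) measure"
  where "disturbance_space S \<equiv> restrict_space borel (disturbances S)"

abbreviation feasible_space :: "('n::finite, 'm::finite, 'l::finite) control_system \<Rightarrow> ('n, 'm) state_input measure"
  where "feasible_space S \<equiv> restrict_space borel (feasible_pairs S)"

text \<open>
  The Borel probability measures on the disturbance set. The sigma-algebra is the one generated by
  the evaluations, which for a Borel subset of a Euclidean space is the Borel sigma-algebra of the
  weak topology.
\<close>

abbreviation distributions :: "('n::finite, 'm::finite, 'l::finite) control_system \<Rightarrow> (real^'l) measure measure"
  where "distributions S \<equiv> prob_algebra (disturbance_space S)"

definition well_posed :: "('n::finite, 'm::finite, 'l::finite) control_system \<Rightarrow> bool"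
  where "well_posed S \<longleftrightarrow>
    states S \<in> sets borel \<and> inputs S \<in> sets borel \<and> disturbances S \<in> sets borel \<and>
    (\<forall>x\<in>states S. admissible S x \<subseteq> inputs S) \<and>
    (\<lambda>((x, u), w). dynamics S x u w)
      \<in> feasible_space S \<Otimes>\<^sub>M disturbance_space S \<rightarrow>\<^sub>M state_space S \<and>
    0 < discount S \<and> discount S < 1"

text \<open>
  A history \<open>(x\<^sub>0, u\<^sub>0, \<dots>, x\<^sub>t)\<close> is represented by the pair of the finite sequence
  \<open>(x\<^sub>s, u\<^sub>s)\<close>, \<open>s < t\<close>, and the current state; an extended history by the pair of the finite
  sequence \<open>((x\<^sub>s, u\<^sub>s), \<mu>\<^sub>s)\<close>, \<open>s < t\<close>, and the current state-input pair.
\<close>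

type_synonym ('n, 'm) history = "(nat \<Rightarrow> ('n, 'm) state_input) \<times> (real^'n)"

type_synonym ('n, 'm, 'l) ext_history =
  "(nat \<Rightarrow> ('n, 'm) state_input \<times> (real^'l) measure) \<times> ('n, 'm) state_input"

type_synonym ('n, 'm) policy = "nat \<Rightarrow> ('n, 'm) history \<Rightarrow> (real^'m) measure"

type_synonym ('n, 'm, 'l) adversary = "nat \<Rightarrow> ('n, 'm, 'l) ext_history \<Rightarrow> (real^'l) measure measure"

definition histories ::
    "('n::finite, 'm::finite, 'l::finite) control_system \<Rightarrow> nat \<Rightarrow> ('n, 'm) history measure"
  where "histories S t = PiM {0..<t} (\<lambda>_. feasible_space S) \<Otimes>\<^sub>M state_space S"

definition ext_histories ::
    "('n::finite, 'm::finite, 'l::finite) control_system \<Rightarrow> nat \<Rightarrow> ('n, 'm, 'l) ext_history measure"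
  where "ext_histories S t =
    PiM {0..<t} (\<lambda>_. feasible_space S \<Otimes>\<^sub>M distributions S) \<Otimes>\<^sub>M feasible_space S"

definition policies :: "('n::finite, 'm::finite, 'l::finite) control_system \<Rightarrow> ('n, 'm) policy set"
  where "policies S = {\<pi>. \<forall>t.
    \<pi> t \<in> histories S t \<rightarrow>\<^sub>M prob_algebra borel \<and>
    (\<forall>h\<in>space (histories S t). emeasure (\<pi> t h) (admissible S (snd h)) = 1)}"

text \<open>
  That the adversary's kernels give the ambiguity set \<open>D\<close> probability one is expressed by
  \<open>AE\<close>, which is equivalent to \<open>emeasure (\<gamma> t h) D = 1\<close> as soon as \<open>D\<close> is
  measurable; a Wasserstein ball of a continuous metric is closed in the weak topology, hence
  measurable.
\<close>

definition adversaries ::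
    "('n::finite, 'm::finite, 'l::finite) control_system \<Rightarrow> (real^'l) measure set \<Rightarrow> ('n, 'm, 'l) adversary set"
  where "adversaries S D = {\<gamma>. \<forall>t.
    \<gamma> t \<in> ext_histories S t \<rightarrow>\<^sub>M prob_algebra (distributions S) \<and>
    (\<forall>h\<in>space (ext_histories S t). AE \<nu> in \<gamma> t h. \<nu> \<in> D)}"

text \<open>
  The law on infinite sequences whose coordinate \<open>t\<close> has conditional law \<open>P t\<close> given
  the coordinates before \<open>t\<close>, by the theorem of Ionescu-Tulcea. This is the limit called
  \<open>PF.lim\<close> inside the locale \<^locale>\<open>Ionescu_Tulcea\<close>.
\<close>

definition trajectory_measure ::
    "(nat \<Rightarrow> (nat \<Rightarrow> 'a) \<Rightarrow> 'a measure) \<Rightarrow> (nat \<Rightarrow> 'a measure) \<Rightarrow> (nat \<Rightarrow> 'a) measure"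
  where "trajectory_measure P M = projective_family.lim UNIV (Ionescu_Tulcea.CI P M) M"

text \<open>
  The law of \<open>(x\<^sub>t, u\<^sub>t)\<close> given the history \<open>h\<close> with current state \<open>x\<^sub>t = snd h\<close>,
  where \<open>\<kappa>\<close> is the kernel of the policy at stage \<open>t\<close>. Since \<open>\<kappa> h\<close> gives
  \<open>admissible S (snd h)\<close> probability one, restricting to that set is again a probability
  measure.
\<close>

definition state_input_law ::
    "('n::finite, 'm::finite, 'l::finite) control_system \<Rightarrow> (('n, 'm) history \<Rightarrow> (real^'m) measure)
      \<Rightarrow> ('n, 'm) history \<Rightarrow> ('n, 'm) state_input measure"
  where "state_input_law S \<kappa> h =
    distr (restrict_space (\<kappa> h) (admissible S (snd h))) (feasible_space S) (\<lambda>u. (snd h, u))"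

text \<open>
  The coordinate \<open>t\<close> of a trajectory of the game is \<open>((x\<^sub>t, u\<^sub>t), \<mu>\<^sub>t, w\<^sub>t)\<close>: first
  \<open>x\<^sub>t = f(x\<^sub>t\<^sub>-\<^sub>1, u\<^sub>t\<^sub>-\<^sub>1, w\<^sub>t\<^sub>-\<^sub>1)\<close>, then \<open>u\<^sub>t\<close> is drawn from \<open>\<pi>\<^sub>t\<close>,
  then \<open>\<mu>\<^sub>t\<close> from \<open>\<gamma>\<^sub>t\<close>, then \<open>w\<^sub>t\<close> from \<open>\<mu>\<^sub>t\<close>.
\<close>

type_synonym ('n, 'm, 'l) game_stage =
  "('n, 'm) state_input \<times> (real^'l) measure \<times> (real^'l)"

definition game_space ::
    "('n::finite, 'm::finite, 'l::finite) control_system \<Rightarrow> ('n, 'm, 'l) game_stage measure"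
  where "game_space S = feasible_space S \<Otimes>\<^sub>M (distributions S \<Otimes>\<^sub>M disturbance_space S)"

fun game_state ::
    "('n::finite, 'm::finite, 'l::finite) control_system \<Rightarrow> real^'n \<Rightarrow> nat
      \<Rightarrow> (nat \<Rightarrow> ('n, 'm, 'l) game_stage) \<Rightarrow> real^'n"
  where
    "game_state S x0 0 z = x0"
  | "game_state S x0 (Suc t) z = (case z t of ((x, u), \<nu>, w) \<Rightarrow> dynamics S x u w)"

definition game_kernel ::
    "('n::finite, 'm::finite, 'l::finite) control_system \<Rightarrow> ('n, 'm) policy \<Rightarrow> ('n, 'm, 'l) adversary
      \<Rightarrow> real^'n \<Rightarrow> nat \<Rightarrow> (nat \<Rightarrow> ('n, 'm, 'l) game_stage) \<Rightarrow> ('n, 'm, 'l) game_stage measure"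
  where "game_kernel S \<pi> \<gamma> x0 t z =
    state_input_law S (\<pi> t) (\<lambda>s\<in>{0..<t}. fst (z s), game_state S x0 t z) \<bind>
      (\<lambda>xu. \<gamma> t (\<lambda>s\<in>{0..<t}. (fst (z s), fst (snd (z s))), xu) \<bind>
        (\<lambda>\<nu>. distr \<nu> (game_space S) (\<lambda>w. (xu, \<nu>, w))))"

definition game_law ::
    "('n::finite, 'm::finite, 'l::finite) control_system \<Rightarrow> ('n, 'm) policy \<Rightarrow> ('n, 'm, 'l) adversary
      \<Rightarrow> real^'n \<Rightarrow> (nat \<Rightarrow> ('n, 'm, 'l) game_stage) measure"
  where "game_law S \<pi> \<gamma> x0 =
    trajectory_measure (game_kernel S \<pi> \<gamma> x0) (\<lambda>_. game_space S)"

text \<open>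
  The closed loop without adversary: the coordinate \<open>t\<close> is \<open>((x\<^sub>t, u\<^sub>t), w\<^sub>t)\<close> with
  \<open>w\<^sub>t\<close> of law \<open>\<mu>\<close> and independent of \<open>u\<^sub>t\<close> and of the past, so that the
  disturbances are i.i.d.
\<close>

type_synonym ('n, 'm, 'l) loop_stage = "('n, 'm) state_input \<times> (real^'l)"

fun loop_state ::
    "('n::finite, 'm::finite, 'l::finite) control_system \<Rightarrow> real^'n \<Rightarrow> nat
      \<Rightarrow> (nat \<Rightarrow> ('n, 'm, 'l) loop_stage) \<Rightarrow> real^'n"
  where
    "loop_state S x0 0 z = x0"
  | "loop_state S x0 (Suc t) z = (case z t of ((x, u), w) \<Rightarrow> dynamics S x u w)"

definition loop_kernel ::
    "('n::finite, 'm::finite, 'l::finite) control_system \<Rightarrow> ('n, 'm) policy \<Rightarrow> (real^'l) measure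
      \<Rightarrow> real^'n \<Rightarrow> nat \<Rightarrow> (nat \<Rightarrow> ('n, 'm, 'l) loop_stage) \<Rightarrow> ('n, 'm, 'l) loop_stage measure"
  where "loop_kernel S \<pi> \<mu> x0 t z =
    state_input_law S (\<pi> t) (\<lambda>s\<in>{0..<t}. fst (z s), loop_state S x0 t z) \<Otimes>\<^sub>M \<mu>"

definition loop_law ::
    "('n::finite, 'm::finite, 'l::finite) control_system \<Rightarrow> ('n, 'm) policy \<Rightarrow> (real^'l) measure
      \<Rightarrow> real^'n \<Rightarrow> (nat \<Rightarrow> ('n, 'm, 'l) loop_stage) measure"
  where "loop_law S \<pi> \<mu> x0 =
    trajectory_measure (loop_kernel S \<pi> \<mu> x0) (\<lambda>_. feasible_space S \<Otimes>\<^sub>M disturbance_space S)"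

definition stage_term ::
    "('n::finite, 'm::finite, 'l::finite) control_system \<Rightarrow> (nat \<Rightarrow> ('n, 'm) state_input \<times> 'r) \<Rightarrow> nat \<Rightarrow> real"
  where "stage_term S \<omega> t = discount S ^ t * (case fst (\<omega> t) of (x, u) \<Rightarrow> stage_cost S x u)"

text \<open>
  The expectation of the total discounted cost. It is set to \<open>\<infinity>\<close> where it does not exist, so
  that the default value \<open>0\<close> of the integral never counts as a cost.
\<close>

definition expected_cost ::
    "('n::finite, 'm::finite, 'l::finite) control_system \<Rightarrow> (nat \<Rightarrow> ('n, 'm) state_input \<times> 'r) measure \<Rightarrow> ereal"
  where "expected_cost S P =
    (if (AE \<omega> in P. summable (stage_term S \<omega>)) \<and> integrable P (\<lambda>\<omega>. \<Sum>t. stage_term S \<omega> t)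
     then ereal (\<integral>\<omega>. (\<Sum>t. stage_term S \<omega> t) \<partial>P) else \<infinity>)"

definition game_cost ::
    "('n::finite, 'm::finite, 'l::finite) control_system \<Rightarrow> ('n, 'm) policy \<Rightarrow> ('n, 'm, 'l) adversary
      \<Rightarrow> real^'n \<Rightarrow> ereal"
  where "game_cost S \<pi> \<gamma> x = expected_cost S (game_law S \<pi> \<gamma> x)"

definition true_cost ::
    "('n::finite, 'm::finite, 'l::finite) control_system \<Rightarrow> ('n, 'm) policy \<Rightarrow> (real^'l) measure
      \<Rightarrow> real^'n \<Rightarrow> ereal"
  where "true_cost S \<pi> \<mu> x = expected_cost S (loop_law S \<pi> \<mu> x)"

definition worst_case_cost ::
    "('n::finite, 'm::finite, 'l::finite) control_system \<Rightarrow> (real^'l) measure set \<Rightarrow> ('n, 'm) policy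
      \<Rightarrow> real^'n \<Rightarrow> ereal"
  where "worst_case_cost S D \<pi> x = (SUP \<gamma>\<in>adversaries S D. game_cost S \<pi> \<gamma> x)"

definition robust_value ::
    "('n::finite, 'm::finite, 'l::finite) control_system \<Rightarrow> (real^'l) measure set \<Rightarrow> real^'n \<Rightarrow> ereal"
  where "robust_value S D x = (INF \<pi>\<in>policies S. worst_case_cost S D \<pi> x)"

definition optimal_robust_policy ::
    "('n::finite, 'm::finite, 'l::finite) control_system \<Rightarrow> (real^'l) measure set \<Rightarrow> ('n, 'm) policy \<Rightarrow> bool"
  where "optimal_robust_policy S D \<pi>' \<longleftrightarrow>
    \<pi>' \<in> policies S \<and>
    (\<forall>\<pi>\<in>policies S. \<forall>x\<in>states S. worst_case_cost S D \<pi>' x \<le> worst_case_cost S D \<pi> x)"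

definition couplings ::
    "('n::finite, 'm::finite, 'l::finite) control_system \<Rightarrow> (real^'l) measure \<Rightarrow> (real^'l) measure
      \<Rightarrow> ((real^'l) \<times> (real^'l)) measure set"
  where "couplings S \<mu> \<nu> =
    {\<kappa> \<in> space (prob_algebra (disturbance_space S \<Otimes>\<^sub>M disturbance_space S)).
      distr \<kappa> (disturbance_space S) fst = \<mu> \<and> distr \<kappa> (disturbance_space S) snd = \<nu>}"

definition ennreal_powr :: "ennreal \<Rightarrow> real \<Rightarrow> ennreal"
  where "ennreal_powr a r = (if a = \<infinity> then \<infinity> else ennreal (enn2real a powr r))"

definition wasserstein ::
    "('n::finite, 'm::finite, 'l::finite) control_system \<Rightarrow> (real^'l \<Rightarrow> real^'l \<Rightarrow> real) \<Rightarrow> real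
      \<Rightarrow> (real^'l) measure \<Rightarrow> (real^'l) measure \<Rightarrow> ennreal"
  where "wasserstein S d p \<mu> \<nu> =
    (INF \<kappa>\<in>couplings S \<mu> \<nu>. ennreal_powr (\<integral>\<^sup>+(w, w'). ennreal (d w w' powr p) \<partial>\<kappa>) (1 / p))"

definition empirical ::
    "('n::finite, 'm::finite, 'l::finite) control_system \<Rightarrow> nat \<Rightarrow> (nat \<Rightarrow> real^'l) \<Rightarrow> (real^'l) measure"
  where "empirical S N w = measure_of (disturbances S) (sets (disturbance_space S))
    (\<lambda>A. ennreal (1 / real N) * (\<Sum>i=1..N. emeasure (return (disturbance_space S) (w i)) A))"

definition ambiguity_set ::
    "('n::finite, 'm::finite, 'l::finite) control_system \<Rightarrow> (real^'l \<Rightarrow> real^'l \<Rightarrow> real) \<Rightarrow> real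
      \<Rightarrow> nat \<Rightarrow> real \<Rightarrow> (nat \<Rightarrow> real^'l) \<Rightarrow> (real^'l) measure set"
  where "ambiguity_set S d p N \<theta> w =
    {\<nu> \<in> space (distributions S). wasserstein S d p \<nu> (empirical S N w) \<le> ennreal \<theta>}"

definition semicontinuous_model ::
    "('n::finite, 'm::finite, 'l::finite) control_system \<Rightarrow> (real^'l) measure set \<Rightarrow> bool"
  where "semicontinuous_model S D \<longleftrightarrow>
    (\<forall>a. openin (top_of_set (feasible_pairs S)) {(x, u) \<in> feasible_pairs S. a < stage_cost S x u}) \<and>
    (\<exists>b \<xi> \<beta>.
      0 \<le> b \<and> continuous_on (states S) \<xi> \<and> (\<forall>x\<in>states S. 1 \<le> \<xi> x) \<and>
      1 \<le> \<beta> \<and> \<beta> < 1 / discount S \<and>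
      (\<forall>(x, u)\<in>feasible_pairs S. \<bar>stage_cost S x u\<bar> \<le> b * \<xi> x) \<and>
      (\<forall>\<nu>\<in>D.
        (\<forall>(x, u)\<in>feasible_pairs S. integrable \<nu> (\<lambda>w. \<xi> (dynamics S x u w))) \<and>
        continuous_on (feasible_pairs S) (\<lambda>(x, u). \<integral>w. \<xi> (dynamics S x u w) \<partial>\<nu>) \<and>
        (\<forall>(x, u)\<in>feasible_pairs S. (\<integral>w. \<xi> (dynamics S x u w) \<partial>\<nu>) \<le> \<beta> * \<xi> x))) \<and>
    (\<forall>g :: real^'n \<Rightarrow> real. continuous_on (states S) g \<and> bounded (g ` states S) \<longrightarrow>
      (\<forall>\<nu>\<in>D. continuous_on (feasible_pairs S) (\<lambda>(x, u). \<integral>w. g (dynamics S x u w) \<partial>\<nu>))) \<and>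
    (\<forall>x\<in>states S. compact (admissible S x)) \<and>
    (\<forall>V. open V \<longrightarrow> openin (top_of_set (states S)) {x \<in> states S. admissible S x \<subseteq> V})"

definition light_tail :: "(real^'l::finite) measure \<Rightarrow> real \<Rightarrow> bool"
  where "light_tail \<mu> q \<longleftrightarrow> (\<integral>\<^sup>+w. ennreal (exp (norm w powr q)) \<partial>\<mu>) < \<infinity>"

text \<open>In the following \<open>l\<close> is the dimension of the disturbance.\<close>

definition small_radius_rate :: "real \<Rightarrow> real \<Rightarrow> real \<Rightarrow> nat \<Rightarrow> real \<Rightarrow> real"
  where "small_radius_rate p l c2 N \<theta> =
    (if p > l / 2 then exp (- c2 * real N * \<theta>\<^sup>2)
     else if p = l / 2 then exp (- c2 * real N * (\<theta> / ln (2 + 1 / \<theta>))\<^sup>2)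
     else exp (- c2 * real N * \<theta> powr (l / p)))"

definition large_radius_rate :: "real \<Rightarrow> real \<Rightarrow> real \<Rightarrow> nat \<Rightarrow> real \<Rightarrow> real"
  where "large_radius_rate p q c2 N \<theta> = exp (- c2 * real N * \<theta> powr (q / p))"

abbreviation sample_law :: "(real^'l::finite) measure \<Rightarrow> nat \<Rightarrow> (nat \<Rightarrow> real^'l) measure"
  where "sample_law \<mu> N \<equiv> PiM {1..N} (\<lambda>_. \<mu>)"

text \<open>
  The outer measure agrees with the measure wherever the event is measurable, which holds for
  every continuous metric \<open>d\<close>.
\<close>

definition concentration_constants ::
    "('n::finite, 'm::finite, 'l::finite) control_system \<Rightarrow> (real^'l \<Rightarrow> real^'l \<Rightarrow> real) \<Rightarrow> real
      \<Rightarrow> real \<Rightarrow> (real^'l) measure \<Rightarrow> real \<Rightarrow> real \<Rightarrow> bool"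
  where "concentration_constants S d p q \<mu> c1 c2 \<longleftrightarrow>
    0 < c1 \<and> 0 < c2 \<and>
    (\<forall>N\<ge>1. \<forall>\<theta>>0.
      outer_measure_of (sample_law \<mu> N)
        {w \<in> space (sample_law \<mu> N). ennreal \<theta> \<le> wasserstein S d p \<mu> (empirical S N w)}
      \<le> ennreal (c1 *
          (small_radius_rate p (real CARD('l)) c2 N \<theta> * indicator {..1} \<theta> +
           large_radius_rate p q c2 N \<theta> * indicator {1<..} \<theta>)))"

text \<open>
  A relation between the parameters and the radius: if \<open>p = l/2\<close>, the radius is given implicitly,
  and it is left undefined for sample sizes \<open>N\<close> between \<open>ln (c1 / \<beta>) / c2\<close> and
  \<open>(ln 3)\<^sup>2 * ln (c1 / \<beta>) / c2\<close>.
\<close>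

definition calibrated_radius ::
    "real \<Rightarrow> real \<Rightarrow> real \<Rightarrow> real \<Rightarrow> real \<Rightarrow> real \<Rightarrow> nat \<Rightarrow> real \<Rightarrow> bool"
  where "calibrated_radius p q l c1 c2 \<beta> N \<theta> \<longleftrightarrow>
    (let r = 1 / (real N * c2) * ln (c1 / \<beta>); n = 1 / c2 * ln (c1 / \<beta>) in
      (real N < n \<and> \<theta> = r powr (p / q)) \<or>
      (real N \<ge> n \<and> p > l / 2 \<and> \<theta> = r powr (1 / 2)) \<or>
      (real N \<ge> n \<and> p < l / 2 \<and> \<theta> = r powr (p / l)) \<or>
      (real N \<ge> (ln 3)\<^sup>2 / c2 * ln (c1 / \<beta>) \<and> p = l / 2 \<and> \<theta> / ln (2 + 1 / \<theta>) = r powr (1 / 2)))"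

end

theory Submission
  imports Defs
begin

text \<open>
  The radius is calibrated so that the concentration inequality bounds the outer measure of
  \<open>{W\<^sub>p(\<mu>, \<nu>\<^sub>N) \<ge> \<theta>}\<close> by \<open>\<beta>\<close>. Outside a measurable cover of this event, \<open>\<mu>\<close> lies in the ambiguity
  set, so Player II may play the constant strategy \<open>\<mu>\<close>. The game then reproduces the closed loop with
  i.i.d. disturbances of law \<open>\<mu>\<close>, whose cost is therefore at most the worst-case cost of the optimal
  policy, that is, the robust value.
\<close>

subsection \<open>Push-forward of Ionescu-Tulcea trajectories\<close>

text \<open>The game and the closed loop live on different sequence spaces: a game coordinate also
  records the distribution chosen by Player II. That one reproduces the other therefore means that
  forgetting this component carries the first law onto the second. Both laws are Ionescu-Tulcea
  limits, so it suffices to compare one-stage kernels, provided that these are measurable in the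
  past. Semicontinuity supplies this: compact values and upper semicontinuity of
  \<open>admissible S\<close> make \<open>feasible_pairs S\<close> a Borel set, so that the law of
  the next state-input pair is a measurable function of the history; lower semicontinuity makes the
  stage cost Borel. A second obstacle is that the constant strategy must lie in an ambiguity set
  almost everywhere, although measurability of that set is not given for a general metric;
  measurability of single points in the space of distributions is enough.\<close>

lemma distr_trajectory_measure:
  assumes "Ionescu_Tulcea P M" and "Ionescu_Tulcea Q L"
    and f[measurable]: "\<And>i. f i \<in> M i \<rightarrow>\<^sub>M L i"
    and PQ: "\<And>n z. z \<in> space (PiM {0..<n} M) \<Longrightarrow>
      distr (P n z) (L n) (f n) = Q n (\<lambda>i\<in>{0..<n}. f i (z i))"
  shows "distr (trajectory_measure P M) (PiM UNIV L) (\<lambda>z i. f i (z i)) = trajectory_measure Q L"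
proof -
  interpret A: Ionescu_Tulcea P M by fact
  interpret B: Ionescu_Tulcea Q L by fact
  \<comment> \<open>The coordinatewise map on the index set \<open>J\<close>. The proof climbs from
    one stage to finite prefixes, then to cylinders over arbitrary finite \<open>J\<close>, then to
    the limit.\<close>
  define F where "F J z = (\<lambda>i\<in>J. f i (z i))" for J z
  have F[measurable]: "F J \<in> PiM J M \<rightarrow>\<^sub>M PiM J L" for J
    unfolding F_def by measurable
  \<comment> \<open>\<open>eP n z\<close> is the law of the prefix \<open>z\<close> prolonged by one
    coordinate drawn from \<open>P n z\<close>. Prolonging and mapping coordinatewise commute, so
    \<open>PQ\<close> passes from kernels to prolonged prefixes.\<close>
  have step: "distr (A.eP n z) (PiM {0..<Suc n} L) (F {0..<Suc n}) = B.eP n (F {0..<n} z)"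
    if z: "z \<in> space (PiM {0..<n} M)" for n z
  proof -
    have Fz: "F {0..<n} z \<in> space (PiM {0..<n} L)"
      using measurable_space[OF F z] .
    have upd: "fun_upd z n \<in> M n \<rightarrow>\<^sub>M PiM {0..<Suc n} M"
      using z by (intro measurable_fun_upd[where J="{0..<n}"]) auto
    have updF: "fun_upd (F {0..<n} z) n \<in> L n \<rightarrow>\<^sub>M PiM {0..<Suc n} L"
      using Fz by (intro measurable_fun_upd[where J="{0..<n}"]) auto
    have s: "sets (P n z) = sets (M n)"
      using A.sets_P[OF z] .
    have eq: "F {0..<Suc n} (z(n := x)) = (F {0..<n} z)(n := f n x)" for x
      by (auto simp: F_def fun_eq_iff)
    have "distr (A.eP n z) (PiM {0..<Suc n} L) (F {0..<Suc n}) =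
        distr (P n z) (PiM {0..<Suc n} L) (\<lambda>x. F {0..<Suc n} (z(n := x)))"
      unfolding A.eP_def
      by (subst distr_distr) (simp_all add: comp_def measurable_cong_sets[OF s refl] upd)
    also have "\<dots> = distr (distr (P n z) (L n) (f n)) (PiM {0..<Suc n} L) (fun_upd (F {0..<n} z) n)"
      by (subst distr_distr) (simp_all add: comp_def measurable_cong_sets[OF s refl] updF eq)
    also have "\<dots> = B.eP n (F {0..<n} z)"
      using PQ[OF z] by (simp add: B.eP_def F_def)
    finally show ?thesis .
  qed
  \<comment> \<open>\<open>C 0 n\<close> started at the empty prefix is the law of the first
    \<open>n\<close> coordinates; it grows by binding with \<open>eP\<close>.\<close>
  have C: "distr (A.C 0 n (\<lambda>_. undefined)) (PiM {0..<n} L) (F {0..<n}) = B.C 0 n (\<lambda>_. undefined)" for n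
  proof (induction n)
    case 0
    show ?case
      by (simp, subst distr_return) (auto simp: F_def restrict_def)
  next
    case (Suc n)
    let ?u = "\<lambda>_. undefined"
    have u: "?u \<in> space (PiM {0..<0} M)"
      by simp
    have s: "sets (A.C 0 n ?u) = sets (PiM {0..<n} M)" "space (A.C 0 n ?u) = space (PiM {0..<n} M)"
      using A.sets_C[OF u, of n] A.space_C[OF u, of n] by simp_all
    \<comment> \<open>The bind over an empty space is a default value, so its exchange with
      \<open>distr\<close> needs a nonempty space.\<close>
    have ne: "space (A.C 0 n ?u) \<noteq> {}"
      using A.prob_space_C[OF u] by (rule prob_space.not_empty)
    have "distr (A.C 0 (Suc n) ?u) (PiM {0..<Suc n} L) (F {0..<Suc n})
        = A.C 0 n ?u \<bind> (\<lambda>z. distr (A.eP n z) (PiM {0..<Suc n} L) (F {0..<Suc n}))"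
      by (simp, rule distr_bind[where K="PiM {0..<Suc n} M"])
        (simp_all add: measurable_cong_sets[OF s(1) refl] ne)
    also have "\<dots> = A.C 0 n ?u \<bind> (\<lambda>z. B.eP n (F {0..<n} z))"
      by (rule bind_cong) (simp_all add: s step)
    also have "\<dots> = distr (A.C 0 n ?u) (PiM {0..<n} L) (F {0..<n}) \<bind> B.eP n"
      by (rule bind_distr[symmetric, where K="PiM {0..<Suc n} L"])
        (simp_all add: measurable_cong_sets[OF s(1) refl] ne)
    finally show ?case
      by (simp add: Suc)
  qed
  \<comment> \<open>A cylinder over a finite \<open>J\<close> depends on a prefix of some length
    \<open>n\<close> only, where both limits are given by \<open>C 0 n\<close>.\<close>
  have emb: "emeasure A.PF.lim (prod_emb UNIV M J (F J -` X \<inter> space (PiM J M))) =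
      emeasure B.PF.lim (prod_emb UNIV L J X)" if J: "finite J" and X: "X \<in> sets (PiM J L)" for J X
  proof -
    obtain n where n: "J \<subseteq> {0..<n}"
      using J A.up_to by blast
    have X': "F J -` X \<inter> space (PiM J M) \<in> sets (PiM J M)"
      using F X by (rule measurable_sets)
    have e: "prod_emb {0..<n} M J (F J -` X \<inter> space (PiM J M)) =
      F {0..<n} -` prod_emb {0..<n} L J X \<inter> space (PiM {0..<n} M)"
    proof -
      have "restrict (F {0..<n} z) J = F J (restrict z J)" for z
        using n by (auto simp: F_def fun_eq_iff)
      moreover have "F {0..<n} z \<in> space (PiM {0..<n} L)" "restrict z J \<in> space (PiM J M)"
        if "z \<in> space (PiM {0..<n} M)" for z
        using measurable_space[OF F that] that n by (auto simp: space_PiM)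
      ultimately show ?thesis
        by (auto simp: prod_emb_def space_PiM)
    qed
    have u: "(\<lambda>_. undefined) \<in> space (PiM {0..<0} M)"
      by simp
    have s: "sets (A.C 0 n (\<lambda>_. undefined)) = sets (PiM {0..<n} M)"
      using A.sets_C[OF u, of n] by simp
    have "emeasure A.PF.lim (prod_emb UNIV M J (F J -` X \<inter> space (PiM J M))) =
      emeasure (A.C 0 n (\<lambda>_. undefined)) (F {0..<n} -` prod_emb {0..<n} L J X \<inter> space (PiM {0..<n} M))"
      using A.lim[OF J X'] A.emeasure_CI[OF n X'] e by simp
    also have "\<dots> = emeasure (B.C 0 n (\<lambda>_. undefined)) (prod_emb {0..<n} L J X)"
      unfolding C[symmetric] using n X s
      by (subst emeasure_distr) (auto simp: measurable_cong_sets[OF s refl] sets_eq_imp_space_eq[OF s]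
          intro!: measurable_prod_emb)
    also have "\<dots> = emeasure B.PF.lim (prod_emb UNIV L J X)"
      using B.lim[OF J X] B.emeasure_CI[OF n X] by simp
    finally show ?thesis .
  qed
  let ?\<phi> = "\<lambda>z i. f i (z i)"
  have "(\<lambda>z. \<lambda>i\<in>UNIV. f i (z i)) \<in> PiM UNIV M \<rightarrow>\<^sub>M PiM UNIV L"
    by measurable
  then have \<phi>: "?\<phi> \<in> PiM UNIV M \<rightarrow>\<^sub>M PiM UNIV L"
    by (simp add: restrict_def)
  then have \<phi>': "?\<phi> \<in> A.PF.lim \<rightarrow>\<^sub>M PiM UNIV L"
    by (simp cong: measurable_cong_sets)
  \<comment> \<open>The cylinder over the empty index set is the whole space, so its mass is the
    total mass. Finiteness is what the uniqueness theorem on boxes below asks for.\<close>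
  have prob: "prob_space A.PF.lim"
  proof
    have "emeasure A.PF.lim (prod_emb UNIV M {} (space (PiM {} M))) = A.CI {} (space (PiM {} M))"
      by (intro A.lim) auto
    also have "\<dots> = 1"
      using prob_space.emeasure_space_1[OF A.PF.prob_space_P, of "{}"] A.PF.space_P[of "{}"] by simp
    finally show "emeasure A.PF.lim (space A.PF.lim) = 1"
      by (simp add: prod_emb_def space_PiM restrict_def)
  qed
  have "distr A.PF.lim (PiM UNIV L) ?\<phi> = B.PF.lim"
  proof (rule measure_eqI_PiM_infinite)
    fix J A assume J: "finite (J :: nat set)" and A: "\<And>i. i \<in> J \<Longrightarrow> A i \<in> sets (L i)"
    have X: "Pi\<^sub>E J A \<in> sets (PiM J L)"
      using J A by (intro sets_PiM_I_finite) auto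
    have fs: "f i x \<in> space (L i)" if "x \<in> space (M i)" for i x
      using measurable_space[OF f that] .
    have "?\<phi> -` prod_emb UNIV L J (Pi\<^sub>E J A) \<inter> space A.PF.lim =
      prod_emb UNIV M J (F J -` Pi\<^sub>E J A \<inter> space (PiM J M))"
      by (auto simp: prod_emb_def space_PiM F_def fs PiE_iff)
    then show "emeasure (distr A.PF.lim (PiM UNIV L) ?\<phi>) (prod_emb UNIV L J (Pi\<^sub>E J A)) =
      emeasure B.PF.lim (prod_emb UNIV L J (Pi\<^sub>E J A))"
      using emb[OF J X] by (subst emeasure_distr[OF \<phi>']) (auto intro!: measurable_prod_emb X)
  next
    show "finite_measure (distr A.PF.lim (PiM UNIV L) ?\<phi>)"
      using prob_space.prob_space_distr[OF prob \<phi>'] by (rule prob_space.axioms)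
  qed simp_all
  then show ?thesis
    by (simp add: trajectory_measure_def)
qed

subsection \<open>Measurability of the model\<close>

lemma state_space_eq [simp]: "space (state_space S) = states S"
  by (simp add: space_restrict_space)

lemma feasible_space_eq [simp]: "space (feasible_space S) = feasible_pairs S"
  by (simp add: space_restrict_space)

text \<open>A point \<open>u\<close> outside the closed set \<open>U x\<close> has a closed ball
  disjoint from \<open>U x\<close>; upper semicontinuity keeps the ball disjoint from
  \<open>U x'\<close> for all \<open>x'\<close> near \<open>x\<close>, which gives a product
  neighbourhood off the graph.\<close>

lemma closedin_graph_usc:
  fixes U :: "'a::metric_space \<Rightarrow> 'b::euclidean_space set"
  assumes cpt: "\<And>x. x \<in> X \<Longrightarrow> compact (U x)"
    and usc: "\<And>V. open V \<Longrightarrow> openin (top_of_set X) {x \<in> X. U x \<subseteq> V}"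
  shows "closedin (top_of_set (X \<times> UNIV)) {(x, u). x \<in> X \<and> u \<in> U x}"
proof -
  have "openin (top_of_set (X \<times> UNIV)) (X \<times> UNIV - {(x, u). x \<in> X \<and> u \<in> U x})"
  proof (subst openin_subopen, intro ballI)
    fix z assume z: "z \<in> X \<times> UNIV - {(x, u). x \<in> X \<and> u \<in> U x}"
    obtain x u where xu: "z = (x, u)"
      by force
    with z have x: "x \<in> X" and u: "u \<notin> U x"
      by auto
    have "open (- U x)" "u \<in> - U x"
      using compact_imp_closed[OF cpt[OF x]] x u by auto
    then obtain e where e: "e > 0" "cball u e \<subseteq> - U x"
      using open_contains_cball by blast
    \<comment> \<open>The closed ball has an open complement, to which \<open>usc\<close> applies;
      the open ball makes the second factor open.\<close>
    define T where "T = {x \<in> X. U x \<subseteq> - cball u e} \<times> ball u e"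
    have "openin (top_of_set (X \<times> UNIV)) T"
      unfolding T_def by (intro openin_Times usc) auto
    moreover have "(x, u) \<in> T"
      using e x by (auto simp: T_def)
    moreover have "T \<subseteq> X \<times> UNIV - {(x, u). x \<in> X \<and> u \<in> U x}"
      using ball_subset_cball by (fastforce simp: T_def)
    ultimately show "\<exists>T. openin (top_of_set (X \<times> UNIV)) T \<and> z \<in> T \<and>
        T \<subseteq> X \<times> UNIV - {(x, u). x \<in> X \<and> u \<in> U x}"
      unfolding xu by blast
  qed
  then show ?thesis
    by (auto simp: closedin_def)
qed

text \<open>Since admissible inputs are inputs, the feasible pairs are the graph of
  \<open>admissible S\<close> over \<open>states S\<close>: a relatively closed subset of a Borel
  set.\<close>

lemma feasible_pairs_measurable:
  fixes S :: "('a::finite, 'b::finite, 'c::finite) control_system"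
  assumes "well_posed S" and "semicontinuous_model S D"
  shows "feasible_pairs S \<in> sets borel"
proof -
  have "feasible_pairs S = {(x, u). x \<in> states S \<and> u \<in> admissible S x}"
    using assms(1) by (auto simp: feasible_pairs_def well_posed_def)
  moreover have "closedin (top_of_set (states S \<times> UNIV)) {(x, u). x \<in> states S \<and> u \<in> admissible S x}"
    using assms(2) by (intro closedin_graph_usc) (auto simp: semicontinuous_model_def)
  ultimately obtain T where T: "closed T" "feasible_pairs S = (states S \<times> UNIV) \<inter> T"
    by (auto simp: closedin_closed)
  have "states S \<times> (UNIV :: (real^'b) set) \<in> sets (borel \<Otimes>\<^sub>M borel)"
    using assms(1) by (intro pair_measureI) (auto simp: well_posed_def)
  then show ?thesis
    using T unfolding borel_prod by auto
qed

lemma stage_cost_measurable: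
  assumes "semicontinuous_model S D"
  shows "(\<lambda>(x, u). stage_cost S x u) \<in> borel_measurable (feasible_space S)"
  unfolding borel_measurable_iff_greater
proof
  fix a
  have "openin (top_of_set (feasible_pairs S)) {(x, u) \<in> feasible_pairs S. a < stage_cost S x u}"
    using assms by (auto simp: semicontinuous_model_def)
  then obtain T where "open T" "{(x, u) \<in> feasible_pairs S. a < stage_cost S x u} = feasible_pairs S \<inter> T"
    by (auto simp: openin_open)
  then show "{w \<in> space (feasible_space S). a < (case w of (x, u) \<Rightarrow> stage_cost S x u)} \<in> sets (feasible_space S)"
    by (auto simp: sets_restrict_space image_iff case_prod_beta' intro!: bexI[of _ T])
qed

text \<open>The difficulty is that the law restricts to a set that varies with the history.
  Evaluated on a measurable set \<open>A\<close> of feasible pairs, the restriction disappears: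
  \<open>A\<close> forces admissibility by itself, and the value is the mass that the policy gives
  to a section of \<open>A\<close>. Such masses are measurable in the history because
  \<open>A\<close> is Borel in the full product space.\<close>

lemma state_input_law_kernel:
  assumes wp: "well_posed S" and G: "feasible_pairs S \<in> sets borel"
    and cpt: "\<And>x. x \<in> states S \<Longrightarrow> compact (admissible S x)"
    and \<pi>: "\<pi> \<in> policies S"
  shows "state_input_law S (\<pi> t) \<in> histories S t \<rightarrow>\<^sub>M prob_algebra (feasible_space S)"
proof -
  let ?H = "histories S t"
  have \<pi>t[measurable]: "\<pi> t \<in> ?H \<rightarrow>\<^sub>M prob_algebra borel"
    and adm: "\<And>h. h \<in> space ?H \<Longrightarrow> emeasure (\<pi> t h) (admissible S (snd h)) = 1"
    using \<pi> by (auto simp: policies_def)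
  have snd_st: "snd \<in> ?H \<rightarrow>\<^sub>M state_space S"
    unfolding histories_def by simp
  then have snd_m[measurable]: "snd \<in> ?H \<rightarrow>\<^sub>M borel"
    by (simp add: measurable_restrict_space2_iff)
  have sp: "sets (\<pi> t h) = sets borel" "space (\<pi> t h) = UNIV" "prob_space (\<pi> t h)"
    "snd h \<in> states S" "admissible S (snd h) \<in> sets borel" if h: "h \<in> space ?H" for h
  proof -
    show s: "sets (\<pi> t h) = sets borel" "prob_space (\<pi> t h)"
      using measurable_space[OF \<pi>t h] by (auto simp: space_prob_algebra)
    show "space (\<pi> t h) = UNIV"
      using sets_eq_imp_space_eq[OF s(1)] by simp
    show x: "snd h \<in> states S"
      using measurable_space[OF snd_st h] by simp
    show "admissible S (snd h) \<in> sets borel"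
      using cpt[OF x] by (intro borel_closed compact_imp_closed)
  qed
  have pair: "Pair (snd h) \<in> restrict_space (\<pi> t h) (admissible S (snd h)) \<rightarrow>\<^sub>M feasible_space S"
    if h: "h \<in> space ?H" for h
  proof (rule measurable_restrict_space3)
    show "Pair (snd h) \<in> \<pi> t h \<rightarrow>\<^sub>M borel"
      unfolding measurable_cong_sets[OF sp(1)[OF h] refl] borel_prod[symmetric] by simp
    show "Pair (snd h) \<in> admissible S (snd h) \<rightarrow> feasible_pairs S"
      using wp sp(4)[OF h] by (auto simp: feasible_pairs_def well_posed_def)
  qed
  have em: "emeasure (state_input_law S (\<pi> t) h) A = emeasure (\<pi> t h) (Pair (snd h) -` A)"
    if h: "h \<in> space ?H" and A: "A \<in> sets (feasible_space S)" for h A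
  proof -
    have A': "A \<subseteq> feasible_pairs S" "A \<in> sets borel"
      using A G by (auto simp: sets_restrict_space_iff)
    have sub: "Pair (snd h) -` A \<subseteq> admissible S (snd h)"
      using A'(1) by (auto simp: feasible_pairs_def)
    have "emeasure (state_input_law S (\<pi> t) h) A =
      emeasure (restrict_space (\<pi> t h) (admissible S (snd h))) (Pair (snd h) -` A \<inter> admissible S (snd h))"
      unfolding state_input_law_def
      using emeasure_distr[OF pair[OF h] A] sp(2)[OF h] by (simp add: space_restrict_space)
    also have "\<dots> = emeasure (\<pi> t h) (Pair (snd h) -` A \<inter> admissible S (snd h))"
      using sp[OF h] by (intro emeasure_restrict_space) auto
    also have "Pair (snd h) -` A \<inter> admissible S (snd h) = Pair (snd h) -` A"
      using sub by blast
    finally show ?thesis .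
  qed
  have prob: "prob_space (state_input_law S (\<pi> t) h)" if h: "h \<in> space ?H" for h
    unfolding state_input_law_def
  proof (rule prob_space.prob_space_distr[OF _ pair[OF h]])
    show "prob_space (restrict_space (\<pi> t h) (admissible S (snd h)))"
      using sp[OF h] adm[OF h] by (intro prob_spaceI) (simp add: space_restrict_space emeasure_restrict_space)
  qed
  show ?thesis
  proof (intro measurable_prob_algebraI measurable_subprob_algebra prob)
    fix h assume "h \<in> space ?H"
    then show "subprob_space (state_input_law S (\<pi> t) h)"
      by (intro prob_space_imp_subprob_space prob)
    show "sets (state_input_law S (\<pi> t) h) = sets (feasible_space S)"
      by (simp add: state_input_law_def)
  next
    fix A assume A: "A \<in> sets (feasible_space S)"
    have [measurable]: "A \<in> sets (borel \<Otimes>\<^sub>M borel)"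
      using A G unfolding borel_prod by (auto simp: sets_restrict_space_iff)
    \<comment> \<open>Joint measurability of the family of sections, as needed to measure sections
      by a kernel.\<close>
    have "(SIGMA h:space ?H. Pair (snd h) -` A) = {z \<in> space (?H \<Otimes>\<^sub>M borel). (snd (fst z), snd z) \<in> A}"
      by (auto simp: space_pair_measure)
    also have "\<dots> \<in> sets (?H \<Otimes>\<^sub>M borel)"
      by measurable
    finally have "(\<lambda>h. emeasure (\<pi> t h) (Pair (snd h) -` A)) \<in> borel_measurable ?H"
      by (rule emeasure_measurable_subprob_algebra2) (rule measurable_prob_algebraD, fact)
    then show "(\<lambda>h. emeasure (state_input_law S (\<pi> t) h) A) \<in> borel_measurable ?H"
      by (subst measurable_cong) (auto simp: em A)
  qed
qed

subsection \<open>The game against a constant adversary\<close>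

lemma dynamics_measurable:
  assumes "well_posed S"
    and [measurable]: "f \<in> N \<rightarrow>\<^sub>M feasible_space S" "g \<in> N \<rightarrow>\<^sub>M disturbance_space S"
  shows "(\<lambda>z. dynamics S (fst (f z)) (snd (f z)) (g z)) \<in> N \<rightarrow>\<^sub>M state_space S"
proof -
  have "(\<lambda>((x, u), w). dynamics S x u w)
      \<in> feasible_space S \<Otimes>\<^sub>M disturbance_space S \<rightarrow>\<^sub>M state_space S"
    using assms(1) by (simp add: well_posed_def)
  from measurable_compose[OF measurable_Pair[OF assms(2,3)] this]
  show ?thesis
    by (simp only: split_def fst_conv snd_conv)
qed

lemma loop_state_measurable:
  assumes "well_posed S" and "x0 \<in> states S"
  shows "loop_state S x0 t \<in> PiM {0..<t} (\<lambda>_. feasible_space S \<Otimes>\<^sub>M disturbance_space S) \<rightarrow>\<^sub>M state_space S"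
proof (cases t)
  case 0
  then have "loop_state S x0 t = (\<lambda>_. x0)"
    by (simp add: fun_eq_iff)
  then show ?thesis
    using assms(2) by simp
next
  case (Suc s)
  let ?L = "PiM {0..<t} (\<lambda>_. feasible_space S \<Otimes>\<^sub>M disturbance_space S)"
  have z[measurable]: "(\<lambda>z. z s) \<in> ?L \<rightarrow>\<^sub>M feasible_space S \<Otimes>\<^sub>M disturbance_space S"
    using Suc by (intro measurable_component_singleton) simp
  have "loop_state S x0 t = (\<lambda>z. dynamics S (fst (fst (z s))) (snd (fst (z s))) (snd (z s)))"
    by (simp add: Suc fun_eq_iff split: prod.split)
  also have "\<dots> \<in> ?L \<rightarrow>\<^sub>M state_space S"
    by (intro dynamics_measurable assms(1)) measurable
  finally show ?thesis .
qed

definition project_stage :: "('n::finite, 'm::finite, 'l::finite) game_stage \<Rightarrow> ('n, 'm, 'l) loop_stage"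
  where "project_stage y = (fst y, snd (snd y))"

lemma project_stage_measurable [measurable]:
  "project_stage \<in> game_space S \<rightarrow>\<^sub>M feasible_space S \<Otimes>\<^sub>M disturbance_space S"
  unfolding project_stage_def game_space_def by measurable

lemma project_stages_measurable:
  "(\<lambda>z. \<lambda>i\<in>I. project_stage (z i)) \<in> PiM I (\<lambda>_. game_space S) \<rightarrow>\<^sub>M
    PiM I (\<lambda>_. feasible_space S \<Otimes>\<^sub>M disturbance_space S)"
  by measurable

lemma insert_distribution_measurable:
  assumes [measurable]: "\<mu> \<in> space (distributions S)"
  shows "(\<lambda>(xu, w). (xu, \<mu>, w)) \<in> feasible_space S \<Otimes>\<^sub>M disturbance_space S \<rightarrow>\<^sub>M game_space S"
  unfolding game_space_def by measurable

text \<open>The state at time \<open>t\<close> reads only coordinate \<open>t - 1\<close>, which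
  survives the restriction, and the dynamics do not see the distribution component.\<close>

lemma game_state_eq_loop_state: "game_state S x0 t z = loop_state S x0 t (\<lambda>i\<in>{0..<t}. project_stage (z i))"
  by (cases t) (simp_all add: project_stage_def split: prod.split)

lemma loop_history_measurable:
  assumes "well_posed S" and "x0 \<in> states S"
  shows "(\<lambda>z. (\<lambda>s\<in>{0..<t}. fst (z s), loop_state S x0 t z))
    \<in> PiM {0..<t} (\<lambda>_. feasible_space S \<Otimes>\<^sub>M disturbance_space S) \<rightarrow>\<^sub>M histories S t"
  unfolding histories_def
proof (rule measurable_Pair[OF measurable_restrict loop_state_measurable[OF assms]])
  fix s assume "s \<in> {0..<t}"
  then have "(\<lambda>z. z s) \<in> PiM {0..<t} (\<lambda>_. feasible_space S \<Otimes>\<^sub>M disturbance_space S) \<rightarrow>\<^sub>M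
      feasible_space S \<Otimes>\<^sub>M disturbance_space S"
    by (rule measurable_component_singleton)
  then show "(\<lambda>z. fst (z s)) \<in> PiM {0..<t} (\<lambda>_. feasible_space S \<Otimes>\<^sub>M disturbance_space S) \<rightarrow>\<^sub>M
      feasible_space S"
    by (rule measurable_compose) (rule measurable_fst)
qed

text \<open>Player II randomizes over distributions, so the constant choice is the Dirac measure at
  \<open>\<mu>\<close> on the space of distributions.\<close>

definition stationary_adversary ::
    "('n::finite, 'm::finite, 'l::finite) control_system \<Rightarrow> (real^'l) measure \<Rightarrow> ('n, 'm, 'l) adversary"
  where "stationary_adversary S \<mu> t h = return (distributions S) \<mu>"

lemma loop_kernel_measurable:
  assumes "well_posed S" and "feasible_pairs S \<in> sets borel"
    and "\<And>x. x \<in> states S \<Longrightarrow> compact (admissible S x)"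
    and "\<pi> \<in> policies S" and "\<mu> \<in> space (distributions S)" and "x0 \<in> states S"
  shows "loop_kernel S \<pi> \<mu> x0 t \<in> PiM {0..<t} (\<lambda>_. feasible_space S \<Otimes>\<^sub>M disturbance_space S)
    \<rightarrow>\<^sub>M prob_algebra (feasible_space S \<Otimes>\<^sub>M disturbance_space S)"
  unfolding loop_kernel_def
proof (rule measurable_pair_prob)
  show "(\<lambda>z. state_input_law S (\<pi> t) (\<lambda>s\<in>{0..<t}. fst (z s), loop_state S x0 t z))
    \<in> PiM {0..<t} (\<lambda>_. feasible_space S \<Otimes>\<^sub>M disturbance_space S) \<rightarrow>\<^sub>M prob_algebra (feasible_space S)"
    by (rule measurable_compose[OF loop_history_measurable[OF assms(1,6)] state_input_law_kernel[OF assms(1-4)]])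
qed (use assms(5) in simp)

lemma Ionescu_Tulcea_prob_algebra:
  assumes "\<And>t. P t \<in> PiM {0..<t} M \<rightarrow>\<^sub>M prob_algebra (M t)"
  shows "Ionescu_Tulcea P M"
proof (rule Ionescu_Tulcea.intro)
  show "P t \<in> PiM {0..<t} M \<rightarrow>\<^sub>M subprob_algebra (M t)" for t
    using assms by (rule measurable_prob_algebraD)
  show "prob_space (P t z)" if "z \<in> space (PiM {0..<t} M)" for t z
    using measurable_space[OF assms that] by (simp add: space_prob_algebra)
qed

text \<open>Drawing \<open>x\<close> and then \<open>w\<close> from a law that does not depend on
  \<open>x\<close> gives independent draws: both sides integrate the masses of the sections of the
  preimage.\<close>

lemma bind_distr_Pair:
  assumes \<sigma>: "\<sigma> \<in> space (prob_algebra X)" and \<mu>: "\<mu> \<in> space (prob_algebra W)"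
    and f[measurable]: "f \<in> X \<Otimes>\<^sub>M W \<rightarrow>\<^sub>M G"
  shows "\<sigma> \<bind> (\<lambda>x. distr \<mu> G (\<lambda>w. f (x, w))) = distr (\<sigma> \<Otimes>\<^sub>M \<mu>) G f"
proof -
  have s[measurable_cong]: "sets \<sigma> = sets X" "sets \<mu> = sets W" and "prob_space \<sigma>" "prob_space \<mu>"
    using \<sigma> \<mu> by (auto simp: space_prob_algebra)
  interpret \<sigma>: prob_space \<sigma> by fact
  interpret \<mu>: prob_space \<mu> by fact
  have k: "(\<lambda>x. distr \<mu> G (\<lambda>w. f (x, w))) \<in> \<sigma> \<rightarrow>\<^sub>M subprob_algebra G"
  proof (rule measurable_prob_algebraD, rule measurable_distr_prob_space2[where M=W])
    show "(\<lambda>x. \<mu>) \<in> \<sigma> \<rightarrow>\<^sub>M prob_algebra W"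
      using \<mu> by (rule measurable_const)
    show "(\<lambda>(x, w). f (x, w)) \<in> \<sigma> \<Otimes>\<^sub>M W \<rightarrow>\<^sub>M G"
      by simp measurable
  qed
  show ?thesis
  proof (rule measure_eqI)
    show "sets (\<sigma> \<bind> (\<lambda>x. distr \<mu> G (\<lambda>w. f (x, w)))) = sets (distr (\<sigma> \<Otimes>\<^sub>M \<mu>) G f)"
      using \<sigma>.not_empty by (subst sets_bind) auto
    fix A assume "A \<in> sets (\<sigma> \<bind> (\<lambda>x. distr \<mu> G (\<lambda>w. f (x, w))))"
    then have A[measurable]: "A \<in> sets G"
      using \<sigma>.not_empty by (subst (asm) sets_bind) auto
    have fA: "f -` A \<inter> space (\<sigma> \<Otimes>\<^sub>M \<mu>) \<in> sets (\<sigma> \<Otimes>\<^sub>M \<mu>)"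
      by measurable
    have "emeasure (\<sigma> \<bind> (\<lambda>x. distr \<mu> G (\<lambda>w. f (x, w)))) A =
        (\<integral>\<^sup>+x. emeasure (distr \<mu> G (\<lambda>w. f (x, w))) A \<partial>\<sigma>)"
      by (rule emeasure_bind[OF \<sigma>.not_empty k A])
    also have "\<dots> = (\<integral>\<^sup>+x. emeasure \<mu> (Pair x -` (f -` A \<inter> space (\<sigma> \<Otimes>\<^sub>M \<mu>))) \<partial>\<sigma>)"
    proof (rule nn_integral_cong)
      fix x assume x: "x \<in> space \<sigma>"
      have "f \<in> \<sigma> \<Otimes>\<^sub>M \<mu> \<rightarrow>\<^sub>M G"
        by measurable
      then have "(\<lambda>w. f (x, w)) \<in> \<mu> \<rightarrow>\<^sub>M G"
        using x by (rule measurable_Pair2)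
      then show "emeasure (distr \<mu> G (\<lambda>w. f (x, w))) A = emeasure \<mu> (Pair x -` (f -` A \<inter> space (\<sigma> \<Otimes>\<^sub>M \<mu>)))"
        using x by (subst emeasure_distr) (auto simp: space_pair_measure intro!: arg_cong[where f="emeasure \<mu>"])
    qed
    also have "\<dots> = emeasure (\<sigma> \<Otimes>\<^sub>M \<mu>) (f -` A \<inter> space (\<sigma> \<Otimes>\<^sub>M \<mu>))"
      by (rule \<mu>.emeasure_pair_measure_alt[symmetric, OF fA])
    also have "\<dots> = emeasure (distr (\<sigma> \<Otimes>\<^sub>M \<mu>) G f) A"
      by (subst emeasure_distr) auto
    finally show "emeasure (\<sigma> \<bind> (\<lambda>x. distr \<mu> G (\<lambda>w. f (x, w)))) A = emeasure (distr (\<sigma> \<Otimes>\<^sub>M \<mu>) G f) A" .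
  qed
qed

text \<open>The Dirac choice collapses the middle draw, and what remains is an independent draw of
  \<open>w\<close> from \<open>\<mu>\<close>. One stage of the game is thus one stage of the loop
  with the constant \<open>\<mu>\<close> inserted.\<close>

lemma game_kernel_stationary:
  assumes wp: "well_posed S" and G: "feasible_pairs S \<in> sets borel"
    and cpt: "\<And>x. x \<in> states S \<Longrightarrow> compact (admissible S x)"
    and \<pi>: "\<pi> \<in> policies S" and \<mu>: "\<mu> \<in> space (distributions S)" and x0: "x0 \<in> states S"
    and z: "z \<in> space (PiM {0..<t} (\<lambda>_. game_space S))"
  shows "game_kernel S \<pi> (stationary_adversary S \<mu>) x0 t z =
    distr (loop_kernel S \<pi> \<mu> x0 t (\<lambda>i\<in>{0..<t}. project_stage (z i))) (game_space S) (\<lambda>(xu, w). (xu, \<mu>, w))"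
proof -
  let ?z = "\<lambda>i\<in>{0..<t}. project_stage (z i)"
  let ?\<sigma> = "state_input_law S (\<pi> t) (\<lambda>s\<in>{0..<t}. fst (z s), game_state S x0 t z)"
  let ?L = "PiM {0..<t} (\<lambda>_. feasible_space S \<Otimes>\<^sub>M disturbance_space S)"
  have h: "(\<lambda>s\<in>{0..<t}. fst (?z s)) = (\<lambda>s\<in>{0..<t}. fst (z s))"
    by (auto simp: project_stage_def)
  have zL: "?z \<in> space ?L"
    by (rule measurable_space[OF project_stages_measurable z])
  have \<sigma>: "?\<sigma> \<in> space (prob_algebra (feasible_space S))"
    using measurable_space[OF state_input_law_kernel[OF wp G cpt \<pi>, of t]
        measurable_space[OF loop_history_measurable[OF wp x0] zL]] unfolding h game_state_eq_loop_state .
  have ne: "space ?\<sigma> = feasible_pairs S"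
    by (simp add: state_input_law_def)
  \<comment> \<open>Evaluating a bind at a Dirac measure requires the continuation to be a
    measurable kernel in all \<open>\<nu>\<close>, not just its value at
    \<open>\<mu>\<close>.\<close>
  have inner: "return (distributions S) \<mu> \<bind> (\<lambda>\<nu>. distr \<nu> (game_space S) (\<lambda>w. (xu, \<nu>, w))) =
      distr \<mu> (game_space S) (\<lambda>w. (xu, \<mu>, w))" if xu: "xu \<in> feasible_pairs S" for xu
  proof (rule bind_return[OF _ \<mu>])
    have [measurable]: "xu \<in> space (feasible_space S)"
      using xu by simp
    show "(\<lambda>\<nu>. distr \<nu> (game_space S) (\<lambda>w. (xu, \<nu>, w))) \<in> distributions S \<rightarrow>\<^sub>M subprob_algebra (game_space S)"
      unfolding game_space_def
    proof (rule measurable_prob_algebraD, rule measurable_distr_prob_space2[where M="disturbance_space S"])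
      show "(\<lambda>\<nu>. \<nu>) \<in> distributions S \<rightarrow>\<^sub>M distributions S"
        by (rule measurable_ident_sets) simp
      show "(\<lambda>(\<nu>, w). (xu, \<nu>, w)) \<in> distributions S \<Otimes>\<^sub>M disturbance_space S \<rightarrow>\<^sub>M
          feasible_space S \<Otimes>\<^sub>M (distributions S \<Otimes>\<^sub>M disturbance_space S)"
        using xu by simp
    qed
  qed
  have "game_kernel S \<pi> (stationary_adversary S \<mu>) x0 t z =
      ?\<sigma> \<bind> (\<lambda>xu. distr \<mu> (game_space S) (\<lambda>w. (xu, \<mu>, w)))"
    unfolding game_kernel_def stationary_adversary_def
    by (rule bind_cong) (simp_all add: ne inner)
  also have "\<dots> = distr (?\<sigma> \<Otimes>\<^sub>M \<mu>) (game_space S) (\<lambda>(xu, w). (xu, \<mu>, w))"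
    using bind_distr_Pair[OF \<sigma> \<mu> insert_distribution_measurable[OF \<mu>]] by simp
  finally show ?thesis
    unfolding loop_kernel_def h game_state_eq_loop_state .
qed

lemma sets_trajectory_measure:
  assumes "Ionescu_Tulcea P M"
  shows "sets (trajectory_measure P M) = sets (PiM UNIV M)"
proof -
  interpret Ionescu_Tulcea P M by fact
  show ?thesis
    by (simp add: trajectory_measure_def)
qed

lemma Ionescu_Tulcea_loop_kernel:
  assumes "well_posed S" and "feasible_pairs S \<in> sets borel"
    and "\<And>x. x \<in> states S \<Longrightarrow> compact (admissible S x)"
    and "\<pi> \<in> policies S" and "\<mu> \<in> space (distributions S)" and "x0 \<in> states S"
  shows "Ionescu_Tulcea (loop_kernel S \<pi> \<mu> x0) (\<lambda>_. feasible_space S \<Otimes>\<^sub>M disturbance_space S)"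
  by (rule Ionescu_Tulcea_prob_algebra) (rule loop_kernel_measurable[OF assms])

text \<open>Measurability is inherited from the loop kernel: on the relevant space the game kernel
  is its push-forward, composed with the projection of the past.\<close>

lemma Ionescu_Tulcea_game_kernel_stationary:
  assumes "well_posed S" and "feasible_pairs S \<in> sets borel"
    and "\<And>x. x \<in> states S \<Longrightarrow> compact (admissible S x)"
    and "\<pi> \<in> policies S" and "\<mu> \<in> space (distributions S)" and "x0 \<in> states S"
  shows "Ionescu_Tulcea (game_kernel S \<pi> (stationary_adversary S \<mu>) x0) (\<lambda>_. game_space S)"
proof (rule Ionescu_Tulcea_prob_algebra)
  fix t
  have "(\<lambda>z. distr (loop_kernel S \<pi> \<mu> x0 t (\<lambda>i\<in>{0..<t}. project_stage (z i))) (game_space S)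
      (\<lambda>(xu, w). (xu, \<mu>, w))) \<in> PiM {0..<t} (\<lambda>_. game_space S) \<rightarrow>\<^sub>M prob_algebra (game_space S)"
    by (rule measurable_compose[OF measurable_compose[OF project_stages_measurable
          loop_kernel_measurable[OF assms]] measurable_distr_prob_space[OF insert_distribution_measurable[OF assms(5)]]])
  then show "game_kernel S \<pi> (stationary_adversary S \<mu>) x0 t
    \<in> PiM {0..<t} (\<lambda>_. game_space S) \<rightarrow>\<^sub>M prob_algebra (game_space S)"
    by (subst measurable_cong) (simp_all add: game_kernel_stationary[OF assms])
qed

lemma distr_game_law_stationary:
  assumes wp: "well_posed S" and G: "feasible_pairs S \<in> sets borel"
    and cpt: "\<And>x. x \<in> states S \<Longrightarrow> compact (admissible S x)"
    and \<pi>: "\<pi> \<in> policies S" and \<mu>: "\<mu> \<in> space (distributions S)" and x0: "x0 \<in> states S"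
  shows "distr (game_law S \<pi> (stationary_adversary S \<mu>) x0)
      (PiM UNIV (\<lambda>_. feasible_space S \<Otimes>\<^sub>M disturbance_space S)) (\<lambda>z i. project_stage (z i)) =
    loop_law S \<pi> \<mu> x0"
  unfolding game_law_def loop_law_def
proof (rule distr_trajectory_measure[OF Ionescu_Tulcea_game_kernel_stationary[OF assms]
      Ionescu_Tulcea_loop_kernel[OF assms] project_stage_measurable])
  let ?L = "feasible_space S \<Otimes>\<^sub>M disturbance_space S"
  fix n :: nat and z assume z: "z \<in> space (PiM {0..<n} (\<lambda>_. game_space S))"
  have s: "sets (loop_kernel S \<pi> \<mu> x0 n (\<lambda>i\<in>{0..<n}. project_stage (z i))) = sets ?L"
    using measurable_space[OF loop_kernel_measurable[OF assms] measurable_space[OF project_stages_measurable z]]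
    by (simp add: space_prob_algebra)
  have "distr (game_kernel S \<pi> (stationary_adversary S \<mu>) x0 n z) ?L project_stage =
      distr (loop_kernel S \<pi> \<mu> x0 n (\<lambda>i\<in>{0..<n}. project_stage (z i))) ?L
        (project_stage \<circ> (\<lambda>(xu, w). (xu, \<mu>, w)))"
    by (subst game_kernel_stationary[OF assms z], simp, rule distr_distr)
      (simp_all add: measurable_cong_sets[OF s refl] insert_distribution_measurable[OF \<mu>])
  \<comment> \<open>Inserting \<open>\<mu>\<close> and forgetting it again is the identity, so the
    projected game kernel is exactly the loop kernel at the projected past.\<close>
  also have "project_stage \<circ> (\<lambda>(xu, w). (xu, \<mu>, w)) = (\<lambda>y. y)"
    by (auto simp: project_stage_def)
  also have "distr (loop_kernel S \<pi> \<mu> x0 n (\<lambda>i\<in>{0..<n}. project_stage (z i))) ?L (\<lambda>y. y) =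
      loop_kernel S \<pi> \<mu> x0 n (\<lambda>i\<in>{0..<n}. project_stage (z i))"
    using s by (intro distr_id2) simp_all
  finally show "distr (game_kernel S \<pi> (stationary_adversary S \<mu>) x0 n z) ?L project_stage =
    loop_kernel S \<pi> \<mu> x0 n (\<lambda>i\<in>{0..<n}. project_stage (z i))" .
qed

section \<open>Transfer of costs along the projection, and admissibility of the constant
  strategy\<close>

lemma expected_cost_distr:
  fixes P :: "(nat \<Rightarrow> ('n::finite, 'm::finite) state_input \<times> 'r) measure"
  assumes c[measurable]: "(\<lambda>(x, u). stage_cost S x u) \<in> borel_measurable (feasible_space S)"
    and \<phi>: "\<phi> \<in> P \<rightarrow>\<^sub>M PiM UNIV (\<lambda>_. feasible_space S \<Otimes>\<^sub>M R)"
    and fst_\<phi>: "\<And>\<omega> t. fst (\<phi> \<omega> t) = fst (\<omega> t)"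
  shows "expected_cost S (distr P (PiM UNIV (\<lambda>_. feasible_space S \<Otimes>\<^sub>M R)) \<phi>) = expected_cost S P"
proof -
  let ?N = "PiM UNIV (\<lambda>_::nat. feasible_space S \<Otimes>\<^sub>M R)"
  have st: "(\<lambda>\<omega>. stage_term S \<omega> t) \<in> borel_measurable ?N" for t
  proof -
    have [measurable]: "(\<lambda>\<omega>. \<omega> t) \<in> ?N \<rightarrow>\<^sub>M feasible_space S \<Otimes>\<^sub>M R"
      by (rule measurable_component_singleton) simp
    have "(\<lambda>\<omega>. discount S ^ t * (case fst (\<omega> t) of (x, u) \<Rightarrow> stage_cost S x u)) \<in> borel_measurable ?N"
      by (intro borel_measurable_times measurable_compose[OF _ c]) measurable
    then show ?thesis
      by (simp add: stage_term_def)
  qed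
  have eq: "stage_term S (\<phi> \<omega>) = stage_term S \<omega>" for \<omega>
    by (simp add: fun_eq_iff stage_term_def fst_\<phi>)
  have [measurable]: "(\<lambda>\<omega>. \<Sum>i<n. stage_term S \<omega> i) \<in> borel_measurable ?N" for n
    using st by measurable
  \<comment> \<open>Almost-sure summability can be pulled back along \<open>\<phi>\<close> once this
    set is measurable; it is the set where the partial sums are Cauchy.\<close>
  have "{\<omega> \<in> space ?N. summable (stage_term S \<omega>)} \<in> sets ?N"
    unfolding summable_iff_convergent Cauchy_convergent_iff[symmetric]
    by (rule sets_Collect_Cauchy) measurable
  note ae = AE_distr_iff[OF \<phi> this]
  have sum: "(\<lambda>\<omega>. \<Sum>t. stage_term S \<omega> t) \<in> borel_measurable ?N"
    by (rule borel_measurable_suminf[OF st])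
  \<comment> \<open>Summability, integrability and the integral all transfer, so the default value
    \<open>\<infinity>\<close> occurs on both sides or on neither.\<close>
  show ?thesis
    unfolding expected_cost_def ae integrable_distr_eq[OF \<phi> sum] integral_distr[OF \<phi> sum] eq ..
qed

text \<open>By second countability the Borel sets have a countable generator closed under
  intersection, so a probability measure is determined by countably many values. The singleton is
  then a countable intersection of level sets of evaluations.\<close>

lemma singleton_in_sets_prob_algebra:
  fixes \<mu> :: "'a::second_countable_topology measure"
  assumes W: "W \<in> sets borel" and \<mu>: "\<mu> \<in> space (prob_algebra (restrict_space borel W))"
  shows "{\<mu>} \<in> sets (prob_algebra (restrict_space borel W))"
proof -
  let ?R = "restrict_space borel W"
  let ?P = "prob_algebra ?R"
  obtain B :: "'a set set" where B: "countable B" "topological_basis B"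
    using ex_countable_basis by blast
  \<comment> \<open>Finite intersections of basic sets: still countable and open, now intersection
    stable. The empty family contributes \<open>UNIV\<close>, the exhausting set in the uniqueness
    argument.\<close>
  define E where "E = Inter ` {F. finite F \<and> F \<subseteq> B}"
  have "countable E"
    unfolding E_def by (intro countable_image countable_Collect_finite_subset B(1))
  have "B \<subseteq> E"
    unfolding E_def by (auto intro!: image_eqI[where x="{b}" for b])
  have open_E: "open X" if "X \<in> E" for X
    using that B(2) by (auto simp: E_def topological_basis_open intro!: open_Inter)
  have UNIV_E: "UNIV \<in> E"
    unfolding E_def by (auto intro!: image_eqI[where x="{}"])
  have "Int_stable E"
  proof (rule Int_stableI)
    fix X Y assume "X \<in> E" "Y \<in> E"
    then obtain F G where "finite F" "F \<subseteq> B" "X = \<Inter>F" "finite G" "G \<subseteq> B" "Y = \<Inter>G"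
      by (auto simp: E_def)
    then show "X \<inter> Y \<in> E"
      unfolding E_def by (intro image_eqI[where x="F \<union> G"]) auto
  qed
  have tb: "topological_basis E"
    using B(2) \<open>B \<subseteq> E\<close> open_E unfolding topological_basis_def by (metis subset_trans)
  have borel_E: "sets borel = sigma_sets UNIV E"
    by (subst borel_eq_countable_basis[OF \<open>countable E\<close> tb]) simp
  have WX: "W \<inter> X \<in> sets ?R" if "X \<in> sets borel" for X
    using that by (auto simp: sets_restrict_space)
  have determined: "\<nu> = \<mu>" if \<nu>: "\<nu> \<in> space ?P"
    and eq: "\<And>X. X \<in> E \<Longrightarrow> measure \<nu> (W \<inter> X) = measure \<mu> (W \<inter> X)" for \<nu>
  proof -
    interpret \<mu>: prob_space \<mu>
      using \<mu> by (simp add: space_prob_algebra)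
    interpret \<nu>: prob_space \<nu>
      using \<nu> by (simp add: space_prob_algebra)
    have s: "sets \<mu> = sets ?R" "sets \<nu> = sets ?R"
      using \<mu> \<nu> by (auto simp: space_prob_algebra)
    have sp: "space \<mu> = W" "space \<nu> = W"
      using s[THEN sets_eq_imp_space_eq] by (auto simp: space_restrict_space)
    \<comment> \<open>Both measures are pushed along the inclusion of \<open>W\<close>, because
      \<open>E\<close> generates the Borel sets of the whole space rather than those of
      \<open>W\<close>.\<close>
    have id: "(\<lambda>x. x) \<in> \<mu> \<rightarrow>\<^sub>M borel" "(\<lambda>x. x) \<in> \<nu> \<rightarrow>\<^sub>M borel"
      by (auto simp: measurable_cong_sets[OF s(1) refl] measurable_cong_sets[OF s(2) refl]
          intro!: measurable_restrict_space1)
    have em: "emeasure (distr \<mu> borel (\<lambda>x. x)) X = emeasure \<mu> (W \<inter> X)"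
      "emeasure (distr \<nu> borel (\<lambda>x. x)) X = emeasure \<nu> (W \<inter> X)" if "X \<in> sets borel" for X
      using that id sp by (simp_all add: emeasure_distr Int_commute)
    have "distr \<mu> borel (\<lambda>x. x) = distr \<nu> borel (\<lambda>x. x)"
    proof (rule measure_eqI_generator_eq[OF \<open>Int_stable E\<close>, where A="\<lambda>_. UNIV"])
      fix X assume "X \<in> E"
      then show "emeasure (distr \<mu> borel (\<lambda>x. x)) X = emeasure (distr \<nu> borel (\<lambda>x. x)) X"
        using open_E[of X] eq[of X] by (simp add: em \<mu>.emeasure_eq_measure \<nu>.emeasure_eq_measure)
    next
      fix i :: nat
      show "emeasure (distr \<mu> borel (\<lambda>x. x)) UNIV \<noteq> \<infinity>"
        by (simp add: em \<mu>.emeasure_eq_measure)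
    qed (use borel_E UNIV_E in auto)
    then have "emeasure \<mu> (W \<inter> X) = emeasure \<nu> (W \<inter> X)" if "X \<in> sets borel" for X
      using em that by metis
    then show "\<nu> = \<mu>"
      using s by (intro measure_eqI) (auto simp: sets_restrict_space)
  qed
  have "{\<mu>} = {\<nu> \<in> space ?P. \<forall>X\<in>E. measure \<nu> (W \<inter> X) = measure \<mu> (W \<inter> X)}"
    using \<mu> determined by auto
  also have "\<dots> \<in> sets ?P"
  proof (rule sets.sets_Collect_countable_All'[OF _ \<open>countable E\<close>])
    fix X assume "X \<in> E"
    then have [measurable]: "W \<inter> X \<in> sets ?R"
      using open_E by (intro WX) auto
    show "{\<nu> \<in> space ?P. measure \<nu> (W \<inter> X) = measure \<mu> (W \<inter> X)} \<in> sets ?P"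
      by measurable
  qed
  finally show ?thesis .
qed

lemma game_cost_stationary:
  assumes wp: "well_posed S" and sc: "semicontinuous_model S D"
    and \<pi>: "\<pi> \<in> policies S" and \<mu>: "\<mu> \<in> space (distributions S)" and x: "x \<in> states S"
  shows "game_cost S \<pi> (stationary_adversary S \<mu>) x = true_cost S \<pi> \<mu> x"
proof -
  let ?P = "game_law S \<pi> (stationary_adversary S \<mu>) x"
  let ?\<phi> = "\<lambda>z i. project_stage (z i)"
  have G: "feasible_pairs S \<in> sets borel"
    using wp sc by (rule feasible_pairs_measurable)
  have cpt: "\<And>x. x \<in> states S \<Longrightarrow> compact (admissible S x)"
    using sc by (simp add: semicontinuous_model_def)
  have "sets ?P = sets (PiM UNIV (\<lambda>_. game_space S))"
    unfolding game_law_def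
    by (rule sets_trajectory_measure[OF Ionescu_Tulcea_game_kernel_stationary[OF wp G cpt \<pi> \<mu> x]])
  then have "?\<phi> \<in> ?P \<rightarrow>\<^sub>M PiM UNIV (\<lambda>_. feasible_space S \<Otimes>\<^sub>M disturbance_space S)"
    using project_stages_measurable[of UNIV S] by (simp add: restrict_def cong: measurable_cong_sets)
  from expected_cost_distr[OF stage_cost_measurable[OF sc] this]
  have "expected_cost S (distr ?P (PiM UNIV (\<lambda>_. feasible_space S \<Otimes>\<^sub>M disturbance_space S)) ?\<phi>) =
      expected_cost S ?P"
    by (simp add: project_stage_def)
  then show ?thesis
    using distr_game_law_stationary[OF wp G cpt \<pi> \<mu> x] by (simp add: game_cost_def true_cost_def)
qed

lemma stationary_adversary_in_adversaries:
  assumes wp: "well_posed S" and \<mu>: "\<mu> \<in> space (distributions S)" and D: "\<mu> \<in> D"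
  shows "stationary_adversary S \<mu> \<in> adversaries S D"
proof -
  \<comment> \<open>\<open>D\<close> itself need not be measurable, hence the detour through the singleton.\<close>
  have "AE \<nu> in return (distributions S) \<mu>. \<nu> = \<mu>"
  proof (subst AE_return[OF \<mu>])
    have "{\<nu> \<in> space (distributions S). \<nu> = \<mu>} = {\<mu>}"
      using \<mu> by auto
    then show "Measurable.pred (distributions S) (\<lambda>\<nu>. \<nu> = \<mu>)"
      using singleton_in_sets_prob_algebra[OF _ \<mu>] wp by (simp add: pred_def well_posed_def)
  qed simp
  then have "AE \<nu> in return (distributions S) \<mu>. \<nu> \<in> D"
    by (rule AE_mp) (simp add: D)
  moreover have "return (distributions S) \<mu> \<in> space (prob_algebra (distributions S))"
    using \<mu> by (simp add: space_prob_algebra prob_space_return)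
  moreover have eq: "stationary_adversary S \<mu> t = (\<lambda>_. return (distributions S) \<mu>)" for t
    by (simp add: fun_eq_iff stationary_adversary_def)
  ultimately show ?thesis
    unfolding adversaries_def eq by simp
qed

lemma true_cost_le_robust_value:
  assumes "well_posed S" and "semicontinuous_model S D" and opt: "optimal_robust_policy S D \<pi>"
    and "\<mu> \<in> space (distributions S)" and "\<mu> \<in> D" and "x \<in> states S"
  shows "true_cost S \<pi> \<mu> x \<le> robust_value S D x"
proof -
  have \<pi>: "\<pi> \<in> policies S"
    using opt by (simp add: optimal_robust_policy_def)
  have "true_cost S \<pi> \<mu> x = game_cost S \<pi> (stationary_adversary S \<mu>) x"
    using assms \<pi> by (simp add: game_cost_stationary)
  also have "\<dots> \<le> worst_case_cost S D \<pi> x"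
    unfolding worst_case_cost_def
    by (rule SUP_upper) (rule stationary_adversary_in_adversaries[OF assms(1,4,5)])
  also have "\<dots> \<le> robust_value S D x"
    unfolding robust_value_def using opt assms(6) by (auto simp: optimal_robust_policy_def intro: INF_greatest)
  finally show ?thesis .
qed

subsection \<open>The calibrated radius\<close>

text \<open>Let \<open>r\<close> solve \<open>c1 * exp (- c2 * N * r) = \<beta>\<close>. Each
  formula for \<open>\<theta>\<close> makes the factor after \<open>c2 * N\<close> in the exponent
  of the active rate equal to \<open>r\<close>, and each threshold on \<open>N\<close> decides
  whether \<open>\<theta>\<close> exceeds 1, that is, which rate is active.\<close>

lemma calibrated_radius_rate:
  fixes l :: nat
  assumes cr: "calibrated_radius p q (real l) c1 c2 \<beta> N \<theta>"
    and p: "1 \<le> p" "p < q" and c: "0 < c1" "0 < c2" and \<beta>: "0 < \<beta>" and N: "1 \<le> N"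
    and \<theta>: "0 < \<theta>" and l: "0 < l"
  shows "c1 * (small_radius_rate p (real l) c2 N \<theta> * indicator {..1} \<theta> +
           large_radius_rate p q c2 N \<theta> * indicator {1<..} \<theta>) \<le> \<beta>"
proof (cases "c1 \<le> \<beta>")
  \<comment> \<open>Here \<open>ln (c1 / \<beta>)\<close> is not positive and the powers of
    \<open>r\<close> carry no information; but the rates are at most 1, so the bound is at most
    \<open>c1\<close>.\<close>
  case True
  have "small_radius_rate p (real l) c2 N \<theta> \<le> 1" "large_radius_rate p q c2 N \<theta> \<le> 1"
    using c by (auto simp: small_radius_rate_def large_radius_rate_def)
  then have "c1 * (small_radius_rate p (real l) c2 N \<theta> * indicator {..1} \<theta> +
           large_radius_rate p q c2 N \<theta> * indicator {1<..} \<theta>) \<le> c1 * 1"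
    using c by (intro mult_left_mono) (auto simp: indicator_def)
  then show ?thesis
    using True by simp
next
  case False
  define r where "r = 1 / (real N * c2) * ln (c1 / \<beta>)"
  define n where "n = 1 / c2 * ln (c1 / \<beta>)"
  have ln: "ln (c1 / \<beta>) > 0"
    using False \<beta> c by simp
  then have r: "r > 0"
    using c N by (simp add: r_def)
  \<comment> \<open>The comparison of \<open>N\<close> with \<open>n\<close> is the comparison of 1
    with \<open>r\<close>.\<close>
  have nr: "n = r * real N"
    using N c by (simp add: n_def r_def)
  have key: "c1 * exp (- c2 * real N * r) = \<beta>"
  proof -
    have "c2 * real N * r = ln (c1 / \<beta>)"
      using N c by (simp add: r_def)
    then have "exp (- c2 * real N * r) = \<beta> / c1"
      using c \<beta> by (simp add: exp_minus)
    then show ?thesis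
      using c by simp
  qed
  consider (1) "real N < n" "\<theta> = r powr (p / q)"
    | (2) "real N \<ge> n" "p > real l / 2" "\<theta> = r powr (1 / 2)"
    | (3) "real N \<ge> n" "p < real l / 2" "\<theta> = r powr (p / real l)"
    | (4) "real N \<ge> (ln 3)\<^sup>2 / c2 * ln (c1 / \<beta>)" "p = real l / 2" "\<theta> / ln (2 + 1 / \<theta>) = r powr (1 / 2)"
    using cr unfolding calibrated_radius_def Let_def r_def n_def by blast
  then show ?thesis
  proof cases
    case 1
    have "r > 1"
      using 1(1) N unfolding nr by simp
    then have "\<theta> > 1"
      using p by (simp add: 1(2))
    moreover have "\<theta> powr (q / p) = r"
      using p r by (simp add: 1(2) powr_powr)
    ultimately show ?thesis
      using key by (simp add: large_radius_rate_def)
  next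
    case 2
    have "r \<le> 1"
      using 2(1) N unfolding nr by (simp add: mult_le_cancel_right2)
    then have "\<theta> \<le> 1"
      using r powr_mono2[of "1/2" r 1] by (simp add: 2(3))
    moreover have "\<theta>\<^sup>2 = r"
      using r by (simp add: 2(3) powr_half_sqrt)
    ultimately show ?thesis
      using key 2(2) by (simp add: small_radius_rate_def)
  next
    case 3
    have "r \<le> 1"
      using 3(1) N unfolding nr by (simp add: mult_le_cancel_right2)
    then have "\<theta> \<le> 1"
      using r p powr_mono2[of "p / real l" r 1] by (simp add: 3(3))
    moreover have "\<theta> powr (real l / p) = r"
      using p r l by (simp add: 3(3) powr_powr)
    ultimately show ?thesis
      using key 3(2) by (simp add: small_radius_rate_def)
  next
    case 4
    have ln3: "ln (3::real) > 0"
      by simp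
    have "(ln 3)\<^sup>2 * r * real N \<le> real N"
      using 4(1) N c by (simp add: r_def)
    then have "(ln 3)\<^sup>2 * r \<le> 1"
      using N by (simp add: mult_le_cancel_right2)
    then have "sqrt ((ln 3)\<^sup>2 * r) \<le> 1"
      by simp
    then have sq: "ln 3 * sqrt r \<le> 1"
      by (simp add: real_sqrt_mult)
    have eq: "\<theta> / ln (2 + 1 / \<theta>) = sqrt r"
      using 4(3) r by (simp add: powr_half_sqrt)
    \<comment> \<open>Origin of \<open>ln 3\<close> in the threshold: if \<open>\<theta>\<close>
      exceeded 1, then \<open>2 + 1 / \<theta>\<close> would be below 3, so the implicit equation
      would give \<open>\<theta> \<le> sqrt r * ln 3\<close>, which the threshold bounds by
      1.\<close>
    have "\<theta> \<le> 1"
    proof (rule ccontr)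
      assume "\<not> \<theta> \<le> 1"
      then have \<theta>1: "\<theta> > 1" by simp
      then have "1 / \<theta> < 1" by simp
      then have l3: "ln (2 + 1 / \<theta>) < ln 3"
        using \<theta> by (intro ln_less_cancel_iff[THEN iffD2]) (auto intro: add_pos_pos)
      have pos: "ln (2 + 1 / \<theta>) > 0"
        using \<theta> by (intro ln_gt_zero) (simp add: add_pos_pos)
      have "\<theta> = sqrt r * ln (2 + 1 / \<theta>)"
        using eq pos by (simp add: field_simps)
      also have "\<dots> \<le> sqrt r * ln 3"
        using l3 r by (intro mult_left_mono) auto
      finally show False
        using sq \<theta>1 by (simp add: mult.commute)
    qed
    moreover have "(\<theta> / ln (2 + 1 / \<theta>))\<^sup>2 = r"
      using r by (simp add: eq)
    ultimately show ?thesis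
      using key 4(2) by (simp add: small_radius_rate_def)
  qed
qed

text \<open>The event is not claimed to be measurable, since \<open>\<pi>_opt\<close> is an
  arbitrary choice of an optimal policy for each dataset. The guarantee is therefore stated as an
  inner probability: a measurable \<open>E\<close> inside the event has mass at least
  \<open>1 - \<beta>\<close>.\<close>

theorem theorem3:
  fixes S :: "('n::finite, 'm::finite, 'l::finite) control_system"
    and d :: "real^'l \<Rightarrow> real^'l \<Rightarrow> real"
    and \<mu> :: "(real^'l) measure"
    and p q c1 c2 \<beta> \<theta> :: real
    and N :: nat
    and \<pi>_opt :: "(nat \<Rightarrow> real^'l) \<Rightarrow> ('n, 'm) policy"
  assumes "well_posed S"
    and "Metric_space (disturbances S) d"
    and "1 \<le> p" and "p < q"
    and "\<mu> \<in> space (distributions S)"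
    and "light_tail \<mu> q"
    and "concentration_constants S d p q \<mu> c1 c2"
    and "0 < \<beta>" and "\<beta> < 1" and "1 \<le> N"
    and "0 < \<theta>" and "calibrated_radius p q (real CARD('l)) c1 c2 \<beta> N \<theta>"
    and "\<forall>w\<in>space (sample_law \<mu> N). semicontinuous_model S (ambiguity_set S d p N \<theta> w)"
    and "\<forall>w\<in>space (sample_law \<mu> N). optimal_robust_policy S (ambiguity_set S d p N \<theta> w) (\<pi>_opt w)"
  shows "\<exists>E\<in>sets (sample_law \<mu> N).
    E \<subseteq> {w \<in> space (sample_law \<mu> N). \<forall>x\<in>states S.
      true_cost S (\<pi>_opt w) \<mu> x \<le> robust_value S (ambiguity_set S d p N \<theta> w) x} \<and>
    measure (sample_law \<mu> N) E \<ge> 1 - \<beta>"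
proof -
  let ?P = "sample_law \<mu> N"
  have "prob_space \<mu>"
    using assms(5) by (simp add: space_prob_algebra)
  then interpret P: prob_space ?P
    by (intro prob_space_PiM)
  define bad where "bad = {w \<in> space ?P. ennreal \<theta> \<le> wasserstein S d p \<mu> (empirical S N w)}"
  have c: "0 < c1" "0 < c2"
    using assms(7) by (auto simp: concentration_constants_def)
  have "outer_measure_of ?P bad \<le> ennreal (c1 *
      (small_radius_rate p (real CARD('l)) c2 N \<theta> * indicator {..1} \<theta> +
       large_radius_rate p q c2 N \<theta> * indicator {1<..} \<theta>))"
    using assms(7,10,11) unfolding concentration_constants_def bad_def by blast
  also have "\<dots> \<le> ennreal \<beta>"
    using calibrated_radius_rate[OF assms(12,3,4) c assms(8,10,11)] by (intro ennreal_leI) simp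
  finally have outer: "outer_measure_of ?P bad \<le> ennreal \<beta>" .
  \<comment> \<open>The outer measure is attained by a measurable cover, whose complement serves as
    \<open>E\<close>. Off \<open>bad\<close> the distance is strictly below \<open>\<theta>\<close>,
    so \<open>\<mu>\<close> lies in the closed ball.\<close>
  obtain B where B: "B \<in> sets ?P" "bad \<subseteq> B" "outer_measure_of ?P bad = emeasure ?P B"
    using outer_measure_of_attain[of bad ?P] by (auto simp: bad_def)
  show ?thesis
  proof (intro bexI conjI)
    show "space ?P - B \<in> sets ?P"
      using B(1) by auto
    have "P.prob B \<le> \<beta>"
      using outer assms(8) unfolding B(3) P.emeasure_eq_measure by simp
    then show "1 - \<beta> \<le> P.prob (space ?P - B)"
      using P.prob_compl[OF B(1)] by simp
    show "space ?P - B \<subseteq> {w \<in> space ?P. \<forall>x\<in>states S.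
      true_cost S (\<pi>_opt w) \<mu> x \<le> robust_value S (ambiguity_set S d p N \<theta> w) x}"
    proof (intro subsetI CollectI conjI ballI)
      fix w x assume w: "w \<in> space ?P - B" and x: "x \<in> states S"
      then have "wasserstein S d p \<mu> (empirical S N w) \<le> ennreal \<theta>"
        using B(2) by (fastforce simp: bad_def not_le[symmetric])
      then have "\<mu> \<in> ambiguity_set S d p N \<theta> w"
        using assms(5) by (simp add: ambiguity_set_def)
      then show "true_cost S (\<pi>_opt w) \<mu> x \<le> robust_value S (ambiguity_set S d p N \<theta> w) x"
        using assms(1,5,13,14) w x by (intro true_cost_le_robust_value) auto
    qed auto
  qed
qed

end
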